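(* Let $R$ be an (associative, unital) double algebra over a field $\mathbb{F}$ equipped with an involution $\sigma$, and assume $R^\circ$ is commutative, split semisimple and finite dimensional over $\mathbb{F}$. Let $A \subseteq R^\sigma := \{r \in R : \sigma(r) = r\}$ be a finite subset. For $a \in A$, let $R_a := \mathbb{F}\langle\langle a \rangle\rangle$. Then there exists a finite universal $\circ$-idempotent basis $B \subseteq \mathbb{F}\langle\langle x \rangle\rangle$ of the family $(R_a)_{a\in A}$, together with a map $\sigma_B : B \to B$ satisfying $\sigma_B \circ \sigma_B = \mathrm{id}_B$, such that $$\sigma(b(a)) = \sigma_B(b)(a) \quad \text{for all } a \in A \text{ and } b \in B.$$
   Context: A double algebra $R$ over $\mathbb{F}$ is an $\mathbb{F}$-vector space with two bilinear multiplications $\bullet$ and $\circ$. Each multiplication is associative with an identity element, denoted $1^\bullet$ and $1^\circ$ respectively. $R^\circ$ denotes the algebra $(R,\circ)$. An involution of $R$ is a linear map $\sigma: R\to R$ such that, for all $a, b$: - $\sigma(\sigma(a)) = a$, - $\sigma(a\bullet b) = \sigma(b)\bullet\sigma(a)$, - $\sigma(a \circ b) = \sigma(b)\circ\sigma(a)$. $\mathbb{F}\langle\langle a \rangle\rangle$ is the smallest subspace of $R$ that contains $a$, $1^\bullet$ and $1^\circ$ and is closed under $\bullet$ and $\circ$. The free double algebra $\mathbb{F}\langle\langle x \rangle\rangle$ is the free such double algebra on one generator $x$; its elements (double polynomials) are formal expressions in $x$, $1^\bullet$ and $1^\circ$ built by linear combinations, $\bullet$ and $\circ$. For $a\in R$,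 $p(a)$ denotes the evaluation of $p$ at $x=a$, with identities mapped to identities. A $\circ$-idempotent is an element $e$ with $e\circ e = e$. A nonzero $\circ$-idempotent of a $\circ$-algebra $S$ is primitive if it is not the sum of two nonzero $\circ$-idempotents $f,g\in S$ with $f\circ g=0$. A $\circ$-idempotent basis of $S$ is a basis of $S$ consisting of primitive $\circ$-idempotents. For the family $(R_a)_{a \in A}$, a universal $\circ$-idempotent basis is a subset $D \subseteq \mathbb{F}\langle\langle x \rangle\rangle$ such that, for every $a\in A$: (i) if $d\neq d'$ in $D$ and $d(a), d'(a)$ are both nonzero, then $d(a)\neq d'(a)$; (ii) the nonzero elements of $\{d(a) : d\in D\}$ form a $\circ$-idempotent basis of $R_a$. *)

theory Defs
  imports Complex_Main "HOL-Library.FuncSet" "Jordan_Normal_Form.Matrix"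
begin

locale double_algebra = vector_space scale
  for scale :: "'f::field \<Rightarrow> 'r::ab_group_add \<Rightarrow> 'r" (infixr "*s" 75) +
  fixes bul :: "'r \<Rightarrow> 'r \<Rightarrow> 'r" (infixl "\<bullet>\<^sub>R" 70)
    and cir :: "'r \<Rightarrow> 'r \<Rightarrow> 'r" (infixl "\<circ>\<^sub>R" 70)
    and one_bul :: 'r ("\<one>\<^sub>\<bullet>")
    and one_cir :: 'r ("\<one>\<^sub>\<circ>")
  assumes bul_add_left: "(a + b) \<bullet>\<^sub>R c = a \<bullet>\<^sub>R c + b \<bullet>\<^sub>R c"
    and bul_add_right: "a \<bullet>\<^sub>R (b + c) = a \<bullet>\<^sub>R b + a \<bullet>\<^sub>R c"
    and bul_scale_left: "(t *s a) \<bullet>\<^sub>R b = t *s (a \<bullet>\<^sub>R b)"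
    and bul_scale_right: "a \<bullet>\<^sub>R (t *s b) = t *s (a \<bullet>\<^sub>R b)"
    and bul_assoc: "(a \<bullet>\<^sub>R b) \<bullet>\<^sub>R c = a \<bullet>\<^sub>R (b \<bullet>\<^sub>R c)"
    and bul_one_left: "\<one>\<^sub>\<bullet> \<bullet>\<^sub>R a = a"
    and bul_one_right: "a \<bullet>\<^sub>R \<one>\<^sub>\<bullet> = a"
    and cir_add_left: "(a + b) \<circ>\<^sub>R c = a \<circ>\<^sub>R c + b \<circ>\<^sub>R c"
    and cir_add_right: "a \<circ>\<^sub>R (b + c) = a \<circ>\<^sub>R b + a \<circ>\<^sub>R c"
    and cir_scale_left: "(t *s a) \<circ>\<^sub>R b = t *s (a \<circ>\<^sub>R b)"
    and cir_scale_right: "a \<circ>\<^sub>R (t *s b) = t *s (a \<circ>\<^sub>R b)"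
    and cir_assoc: "(a \<circ>\<^sub>R b) \<circ>\<^sub>R c = a \<circ>\<^sub>R (b \<circ>\<^sub>R c)"
    and cir_one_left: "\<one>\<^sub>\<circ> \<circ>\<^sub>R a = a"
    and cir_one_right: "a \<circ>\<^sub>R \<one>\<^sub>\<circ> = a"

definition double_algebra_hom ::
  "('f::field \<Rightarrow> 'r::ab_group_add \<Rightarrow> 'r) \<Rightarrow> ('r \<Rightarrow> 'r \<Rightarrow> 'r) \<Rightarrow> ('r \<Rightarrow> 'r \<Rightarrow> 'r) \<Rightarrow> 'r \<Rightarrow> 'r \<Rightarrow>
   ('f \<Rightarrow> 's::ab_group_add \<Rightarrow> 's) \<Rightarrow> ('s \<Rightarrow> 's \<Rightarrow> 's) \<Rightarrow> ('s \<Rightarrow> 's \<Rightarrow> 's) \<Rightarrow> 's \<Rightarrow> 's \<Rightarrow>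
   ('r \<Rightarrow> 's) \<Rightarrow> bool" where
  "double_algebra_hom scale bul cir one_bul one_cir scale' bul' cir' one_bul' one_cir' h \<longleftrightarrow>
     Vector_Spaces.linear scale scale' h \<and>
     (\<forall>p q. h (bul p q) = bul' (h p) (h q)) \<and>
     (\<forall>p q. h (cir p q) = cir' (h p) (h q)) \<and>
     h one_bul = one_bul' \<and> h one_cir = one_cir'"

text \<open>Formal expressions in one variable, taken modulo the smallest congruence
  containing the double algebra axioms. That this gives the free object is confirmed
  by \<open>double_algebra_dpoly\<close> and \<open>free_double_algebra_universal\<close> below.\<close>

datatype 'f dterm =
    TX
  | TOneB
  | TOneC
  | TZero
  | TAdd "'f dterm" "'f dterm"
  | TScale 'f "'f dterm"
  | TBul "'f dterm" "'f dterm"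
  | TCir "'f dterm" "'f dterm"

inductive dcong :: "'f::field dterm \<Rightarrow> 'f dterm \<Rightarrow> bool" where
  refl: "dcong p p"
| sym: "dcong p q \<Longrightarrow> dcong q p"
| trans: "dcong p q \<Longrightarrow> dcong q r \<Longrightarrow> dcong p r"
| cong_add: "dcong p p' \<Longrightarrow> dcong q q' \<Longrightarrow> dcong (TAdd p q) (TAdd p' q')"
| cong_scale: "dcong p p' \<Longrightarrow> dcong (TScale t p) (TScale t p')"
| cong_bul: "dcong p p' \<Longrightarrow> dcong q q' \<Longrightarrow> dcong (TBul p q) (TBul p' q')"
| cong_cir: "dcong p p' \<Longrightarrow> dcong q q' \<Longrightarrow> dcong (TCir p q) (TCir p' q')"
| add_assoc: "dcong (TAdd (TAdd p q) r) (TAdd p (TAdd q r))"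
| add_comm: "dcong (TAdd p q) (TAdd q p)"
| add_zero: "dcong (TAdd TZero p) p"
| add_neg: "dcong (TAdd (TScale (- 1) p) p) TZero"
| scale_add: "dcong (TScale t (TAdd p q)) (TAdd (TScale t p) (TScale t q))"
| add_scale: "dcong (TScale (s + t) p) (TAdd (TScale s p) (TScale t p))"
| scale_scale: "dcong (TScale s (TScale t p)) (TScale (s * t) p)"
| scale_one: "dcong (TScale 1 p) p"
| bul_add_l: "dcong (TBul (TAdd p q) r) (TAdd (TBul p r) (TBul q r))"
| bul_add_r: "dcong (TBul p (TAdd q r)) (TAdd (TBul p q) (TBul p r))"
| bul_scale_l: "dcong (TBul (TScale t p) q) (TScale t (TBul p q))"
| bul_scale_r: "dcong (TBul p (TScale t q)) (TScale t (TBul p q))"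
| bul_assoc: "dcong (TBul (TBul p q) r) (TBul p (TBul q r))"
| bul_one_l: "dcong (TBul TOneB p) p"
| bul_one_r: "dcong (TBul p TOneB) p"
| cir_add_l: "dcong (TCir (TAdd p q) r) (TAdd (TCir p r) (TCir q r))"
| cir_add_r: "dcong (TCir p (TAdd q r)) (TAdd (TCir p q) (TCir p r))"
| cir_scale_l: "dcong (TCir (TScale t p) q) (TScale t (TCir p q))"
| cir_scale_r: "dcong (TCir p (TScale t q)) (TScale t (TCir p q))"
| cir_assoc: "dcong (TCir (TCir p q) r) (TCir p (TCir q r))"
| cir_one_l: "dcong (TCir TOneC p) p"
| cir_one_r: "dcong (TCir p TOneC) p"

quotient_type (overloaded) 'f dpoly = "'f::field dterm" / dcong
  by (rule equivpI)
     (auto intro!: reflpI sympI transpI intro: dcong.refl dcong.sym dcong.trans)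

instantiation dpoly :: (field) ab_group_add
begin

lift_definition zero_dpoly :: "'a dpoly" is TZero .
lift_definition plus_dpoly :: "'a dpoly \<Rightarrow> 'a dpoly \<Rightarrow> 'a dpoly" is TAdd
  by (rule dcong.cong_add)
lift_definition uminus_dpoly :: "'a dpoly \<Rightarrow> 'a dpoly" is "TScale (- 1)"
  by (rule dcong.cong_scale)
definition minus_dpoly :: "'a dpoly \<Rightarrow> 'a dpoly \<Rightarrow> 'a dpoly" where
  "minus_dpoly p q = p + (- q)"

instance
proof
  fix a b c :: "'a dpoly"
  show "a + b + c = a + (b + c)" by transfer (rule dcong.add_assoc)
  show "a + b = b + a" by transfer (rule dcong.add_comm)
  show "0 + a = a" by transfer (rule dcong.add_zero)
  show "- a + a = 0" by transfer (rule dcong.add_neg)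
  show "a - b = a + - b" by (rule minus_dpoly_def)
qed

end

lift_definition dscale :: "'f::field \<Rightarrow> 'f dpoly \<Rightarrow> 'f dpoly" is TScale
  by (rule dcong.cong_scale)
lift_definition dbul :: "'f::field dpoly \<Rightarrow> 'f dpoly \<Rightarrow> 'f dpoly" is TBul
  by (rule dcong.cong_bul)
lift_definition dcir :: "'f::field dpoly \<Rightarrow> 'f dpoly \<Rightarrow> 'f dpoly" is TCir
  by (rule dcong.cong_cir)
lift_definition done_bul :: "'f::field dpoly" is TOneB .
lift_definition done_cir :: "'f::field dpoly" is TOneC .
lift_definition dX :: "'f::field dpoly" is TX .

lemma double_algebra_dpoly: "double_algebra dscale dbul dcir done_bul done_cir"
  by unfold_locales (transfer, rule dcong.add_assoc dcong.scale_add dcong.add_scale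
    dcong.scale_scale dcong.scale_one dcong.bul_add_l dcong.bul_add_r dcong.bul_scale_l
    dcong.bul_scale_r dcong.bul_assoc dcong.bul_one_l dcong.bul_one_r dcong.cir_add_l
    dcong.cir_add_r dcong.cir_scale_l dcong.cir_scale_r dcong.cir_assoc dcong.cir_one_l
    dcong.cir_one_r)+

context double_algebra
begin

primrec eval_dterm :: "'r \<Rightarrow> 'f dterm \<Rightarrow> 'r" where
  "eval_dterm a TX = a"
| "eval_dterm a TOneB = \<one>\<^sub>\<bullet>"
| "eval_dterm a TOneC = \<one>\<^sub>\<circ>"
| "eval_dterm a TZero = 0"
| "eval_dterm a (TAdd p q) = eval_dterm a p + eval_dterm a q"
| "eval_dterm a (TScale t p) = t *s eval_dterm a p"
| "eval_dterm a (TBul p q) = eval_dterm a p \<bullet>\<^sub>R eval_dterm a q"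
| "eval_dterm a (TCir p q) = eval_dterm a p \<circ>\<^sub>R eval_dterm a q"

lemma eval_dterm_cong: "dcong p q \<Longrightarrow> eval_dterm a p = eval_dterm a q"
  by (induction rule: dcong.induct)
     (simp_all only: eval_dterm.simps bul_add_left bul_add_right bul_scale_left bul_scale_right
        bul_assoc bul_one_left bul_one_right cir_add_left cir_add_right cir_scale_left
        cir_scale_right cir_assoc cir_one_left cir_one_right add_0_left right_minus
        scale_right_distrib scale_left_distrib scale_scale scale_one scale_minus_left ac_simps)

lift_definition dpoly_eval :: "'f dpoly \<Rightarrow> 'r \<Rightarrow> 'r" is "\<lambda>p a. eval_dterm a p"
  by (rule ext) (rule eval_dterm_cong)

definition generated :: "'r \<Rightarrow> 'r set" where
  "generated a = \<Inter>{S. subspace S \<and> a \<in> S \<and> \<one>\<^sub>\<bullet> \<in> S \<and> \<one>\<^sub>\<circ> \<in> S \<and>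
     (\<forall>p\<in>S. \<forall>q\<in>S. p \<bullet>\<^sub>R q \<in> S) \<and> (\<forall>p\<in>S. \<forall>q\<in>S. p \<circ>\<^sub>R q \<in> S)}"

definition involution :: "('r \<Rightarrow> 'r) \<Rightarrow> bool" where
  "involution \<sigma> \<longleftrightarrow> Vector_Spaces.linear scale scale \<sigma> \<and>
     (\<forall>a. \<sigma> (\<sigma> a) = a) \<and>
     (\<forall>a b. \<sigma> (a \<bullet>\<^sub>R b) = \<sigma> b \<bullet>\<^sub>R \<sigma> a) \<and>
     (\<forall>a b. \<sigma> (a \<circ>\<^sub>R b) = \<sigma> b \<circ>\<^sub>R \<sigma> a)"

definition circ_idempotent :: "'r \<Rightarrow> bool" where
  "circ_idempotent e \<longleftrightarrow> e \<circ>\<^sub>R e = e"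

definition primitive_circ_idempotent :: "'r set \<Rightarrow> 'r \<Rightarrow> bool" where
  "primitive_circ_idempotent S e \<longleftrightarrow> e \<in> S \<and> circ_idempotent e \<and> e \<noteq> 0 \<and>
     \<not> (\<exists>f\<in>S. \<exists>g\<in>S. circ_idempotent f \<and> circ_idempotent g \<and> f \<noteq> 0 \<and> g \<noteq> 0 \<and>
          f \<circ>\<^sub>R g = 0 \<and> e = f + g)"

definition circ_idempotent_basis :: "'r set \<Rightarrow> 'r set \<Rightarrow> bool" where
  "circ_idempotent_basis S E \<longleftrightarrow>
     independent E \<and> span E = S \<and> (\<forall>e\<in>E. primitive_circ_idempotent S e)"

definition universal_circ_idempotent_basis :: "'r set \<Rightarrow> 'f dpoly set \<Rightarrow> bool" where
  "universal_circ_idempotent_basis A D \<longleftrightarrow> (\<forall>a\<in>A.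
     (\<forall>d\<in>D. \<forall>d'\<in>D. d \<noteq> d' \<longrightarrow> dpoly_eval d a \<noteq> 0 \<longrightarrow> dpoly_eval d' a \<noteq> 0 \<longrightarrow>
        dpoly_eval d a \<noteq> dpoly_eval d' a) \<and>
     circ_idempotent_basis (generated a) {r. r \<noteq> 0 \<and> (\<exists>d\<in>D. r = dpoly_eval d a)})"

end

theorem (in double_algebra) free_double_algebra_universal:
  "\<exists>!h. double_algebra_hom dscale dbul dcir done_bul done_cir
          scale bul cir one_bul one_cir h \<and> h dX = a"
  "double_algebra_hom dscale dbul dcir done_bul done_cir
     scale bul cir one_bul one_cir (\<lambda>p. dpoly_eval p a)"
  "dpoly_eval dX a = a"
proof -
  interpret D: double_algebra dscale dbul dcir done_bul done_cir
    by (rule double_algebra_dpoly)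
  have add: "dpoly_eval (p + q) a = dpoly_eval p a + dpoly_eval q a" for p q
    by transfer simp
  have sc: "dpoly_eval (dscale t p) a = t *s dpoly_eval p a" for t p
    by transfer simp
  have bu: "dpoly_eval (dbul p q) a = dpoly_eval p a \<bullet>\<^sub>R dpoly_eval q a" for p q
    by transfer simp
  have ci: "dpoly_eval (dcir p q) a = dpoly_eval p a \<circ>\<^sub>R dpoly_eval q a" for p q
    by transfer simp
  have ob: "dpoly_eval done_bul a = \<one>\<^sub>\<bullet>" by transfer simp
  have oc: "dpoly_eval done_cir a = \<one>\<^sub>\<circ>" by transfer simp
  show X: "dpoly_eval dX a = a" by transfer simp
  show H: "double_algebra_hom dscale dbul dcir done_bul done_cir
     scale bul cir one_bul one_cir (\<lambda>p. dpoly_eval p a)"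
    unfolding double_algebra_hom_def Vector_Spaces.linear_def
      module_hom_def module_hom_axioms_def
    using D.vector_space_axioms vector_space_axioms D.module_axioms module_axioms
    by (simp add: add sc bu ci ob oc)
  have uniq: "h p = dpoly_eval p a"
    if h: "double_algebra_hom dscale dbul dcir done_bul done_cir
             scale bul cir one_bul one_cir h" and hX: "h dX = a" for h p
  proof -
    interpret h: Vector_Spaces.linear dscale scale h
      using h by (simp add: double_algebra_hom_def)
    have "h (abs_dpoly u) = eval_dterm a u" for u
    proof (induction u)
      case TX then show ?case using hX by (simp add: dX.abs_eq[symmetric])
    next
      case TOneB then show ?case
        using h by (simp add: double_algebra_hom_def done_bul.abs_eq[symmetric])
    next
      case TOneC then show ?case
        using h by (simp add: double_algebra_hom_def done_cir.abs_eq[symmetric])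
    next
      case TZero then show ?case
        using h.zero by (simp add: zero_dpoly.abs_eq[symmetric])
    next
      case (TAdd u v) then show ?case
        using h.add by (simp add: plus_dpoly.abs_eq[symmetric])
    next
      case (TScale t u) then show ?case
        using h.scale by (simp add: dscale.abs_eq[symmetric])
    next
      case (TBul u v) then show ?case
        using h by (simp add: double_algebra_hom_def dbul.abs_eq[symmetric])
    next
      case (TCir u v) then show ?case
        using h by (simp add: double_algebra_hom_def dcir.abs_eq[symmetric])
    qed
    moreover have "\<exists>u. p = abs_dpoly u"
      by (rule dpoly.abs_induct) blast
    ultimately show ?thesis
      by (auto simp only: dpoly_eval.abs_eq)
  qed
  show "\<exists>!h. double_algebra_hom dscale dbul dcir done_bul done_cir
          scale bul cir one_bul one_cir h \<and> h dX = a"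
  proof (rule ex1I[of _ "\<lambda>p. dpoly_eval p a"])
    show "double_algebra_hom dscale dbul dcir done_bul done_cir
            scale bul cir one_bul one_cir (\<lambda>p. dpoly_eval p a) \<and> dpoly_eval dX a = a"
      using H X by (rule conjI)
  next
    fix h
    assume "double_algebra_hom dscale dbul dcir done_bul done_cir
              scale bul cir one_bul one_cir h \<and> h dX = a"
    then show "h = (\<lambda>p. dpoly_eval p a)"
      by (intro ext uniq) (erule conjunct1, erule conjunct2)
  qed
qed

text \<open>Split semisimple over \<open>F\<close> means isomorphic as an \<open>F\<close>-algebra to a finite direct product
  of full matrix algebras over \<open>F\<close> (the empty product being the zero algebra).\<close>

definition split_semisimple ::
  "('f::field \<Rightarrow> 'r::ab_group_add \<Rightarrow> 'r) \<Rightarrow> ('r \<Rightarrow> 'r \<Rightarrow> 'r) \<Rightarrow> 'r \<Rightarrow> bool" where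
  "split_semisimple scale mul e \<longleftrightarrow>
     (\<exists>(k::nat) (n :: nat \<Rightarrow> nat) (\<phi> :: 'r \<Rightarrow> nat \<Rightarrow> 'f mat).
        (\<forall>i<k. n i > 0) \<and>
        bij_betw \<phi> UNIV (\<Pi>\<^sub>E i\<in>{..<k}. carrier_mat (n i) (n i)) \<and>
        (\<forall>i<k. (\<forall>a b. \<phi> (a + b) i = \<phi> a i + \<phi> b i) \<and>
               (\<forall>t a. \<phi> (scale t a) i = t \<cdot>\<^sub>m \<phi> a i) \<and>
               (\<forall>a b. \<phi> (mul a b) i = \<phi> a i * \<phi> b i) \<and>
               \<phi> e i = 1\<^sub>m (n i)))"

definition finite_dimensional ::
  "('f::field \<Rightarrow> 'r::ab_group_add \<Rightarrow> 'r) \<Rightarrow> bool" where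
  "finite_dimensional scale \<longleftrightarrow> (\<exists>B. finite B \<and> module.span scale B = UNIV)"

end

theory Submission imports Defs begin

text \<open>By commutativity the \<open>\<circ>\<close>-algebra \<open>R\<close> is a power of the field, so it has finitely many
  characters \<open>\<pi>\<close>, which jointly separate points. Each pair \<open>(a, \<pi>)\<close> gives a character
  \<open>p \<mapsto> \<pi> (p(a))\<close> of the free double algebra with respect to \<open>\<circ>\<close>. The finitely many distinct ones
  among these admit a dual family of double polynomials, and this family is the universal
  basis: at \<open>a\<close>, the member dual to \<open>\<chi>\<close> is the indicator of those \<open>\<pi>\<close> for which \<open>(a, \<pi>)\<close> induces \<open>\<chi>\<close>.
  Reversing all products in a double polynomial permutes the characters and thereby
  the dual family.\<close>

context double_algebra
begin

section \<open>Characters of a \<open>\<circ>\<close>-algebra and their separation\<close>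

definition cir_character :: "('r \<Rightarrow> 'f) \<Rightarrow> bool" where
  "cir_character \<chi> \<longleftrightarrow> (\<forall>x y. \<chi> (x + y) = \<chi> x + \<chi> y) \<and> (\<forall>t x. \<chi> (t *s x) = t * \<chi> x) \<and>
     (\<forall>x y. \<chi> (x \<circ>\<^sub>R y) = \<chi> x * \<chi> y) \<and> \<chi> \<one>\<^sub>\<circ> = 1"

lemma cir_characterD:
  assumes "cir_character \<chi>"
  shows "\<chi> (x + y) = \<chi> x + \<chi> y" "\<chi> (t *s x) = t * \<chi> x" "\<chi> (x \<circ>\<^sub>R y) = \<chi> x * \<chi> y"
    "\<chi> \<one>\<^sub>\<circ> = 1" "\<chi> 0 = 0" "\<chi> (x - y) = \<chi> x - \<chi> y"
proof -
  show add: "\<chi> (x + y) = \<chi> x + \<chi> y" for x y using assms by (simp add: cir_character_def)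
  show scale: "\<chi> (t *s x) = t * \<chi> x" for t x using assms by (simp add: cir_character_def)
  show "\<chi> (x \<circ>\<^sub>R y) = \<chi> x * \<chi> y" "\<chi> \<one>\<^sub>\<circ> = 1"
    using assms by (simp_all add: cir_character_def)
  show "\<chi> 0 = 0" using scale[of 0 0] by simp
  show "\<chi> (x - y) = \<chi> x - \<chi> y" using add[of "x - y" y] by (simp add: algebra_simps)
qed

lemma cir_character_sum:
  assumes "cir_character \<chi>"
  shows "\<chi> (sum g S) = (\<Sum>s\<in>S. \<chi> (g s))"
  by (induction S rule: infinite_finite_induct) (simp_all add: cir_characterD[OF assms])

text \<open>Multiply together, over all \<open>\<psi>\<close> in \<open>Y\<close>, elements on which
  \<open>\<psi>\<close> vanishes and \<open>\<chi>\<close> is 1; multiplicativity preserves both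
  properties.\<close>

lemma cir_character_separation:
  assumes "finite Y" "\<And>\<psi>. \<psi> \<in> Y \<Longrightarrow> cir_character \<psi>" "cir_character \<chi>" "\<chi> \<notin> Y"
  shows "\<exists>p. \<chi> p = 1 \<and> (\<forall>\<psi>\<in>Y. \<psi> p = 0)"
  using assms
proof (induction Y rule: finite_induct)
  case empty
  then show ?case using cir_characterD(4) by blast
next
  case (insert \<omega> Y)
  then obtain p where p: "\<chi> p = 1" "\<forall>\<psi>\<in>Y. \<psi> p = 0" by auto
  have chars: "cir_character \<omega>" "\<And>\<psi>. \<psi> \<in> Y \<Longrightarrow> cir_character \<psi>" using insert.prems by auto
  have "\<chi> \<noteq> \<omega>" using insert.prems by blast
  then obtain q where q: "\<chi> q \<noteq> \<omega> q" by blast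
  \<comment> \<open>Subtracting a multiple of the identity kills \<open>\<omega>\<close>; the scalar
    in front normalises the value at \<open>\<chi>\<close>.\<close>
  define u where "u = inverse (\<chi> q - \<omega> q) *s (q - \<omega> q *s \<one>\<^sub>\<circ>)"
  have "\<chi> u = 1" "\<omega> u = 0"
    using q by (simp_all add: u_def cir_characterD[OF insert.prems(2)] cir_characterD[OF chars(1)])
  then have "\<chi> (p \<circ>\<^sub>R u) = 1 \<and> (\<forall>\<psi>\<in>insert \<omega> Y. \<psi> (p \<circ>\<^sub>R u) = 0)"
    using p chars insert.prems(2) by (simp add: cir_characterD(3))
  then show ?case by blast
qed

text \<open>Used in the free double algebra, where it supplies the universal basis.\<close>

lemma cir_character_dual_family:
  assumes "finite X" "\<And>\<psi>. \<psi> \<in> X \<Longrightarrow> cir_character \<psi>"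
  shows "\<exists>b. \<forall>\<chi>\<in>X. \<forall>\<psi>\<in>X. \<psi> (b \<chi>) = (if \<psi> = \<chi> then 1 else 0)"
proof -
  have "\<exists>p. \<forall>\<psi>\<in>X. \<psi> p = (if \<psi> = \<chi> then 1 else 0)" if "\<chi> \<in> X" for \<chi>
    using cir_character_separation[of "X - {\<chi>}" \<chi>] assms that by auto
  then show ?thesis by metis
qed

text \<open>A character outside \<open>X\<close> would be 1 on some element at which all of
  \<open>X\<close> vanishes, but \<open>X\<close> separates that element from nothing but nonzero
  ones, so it is 0.\<close>

lemma cir_character_in_separating_set:
  assumes "finite X" "\<And>\<psi>. \<psi> \<in> X \<Longrightarrow> cir_character \<psi>" "cir_character \<chi>"
    and "\<And>x y. (\<And>\<psi>. \<psi> \<in> X \<Longrightarrow> \<psi> x = \<psi> y) \<Longrightarrow> x = y"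
  shows "\<chi> \<in> X"
proof (rule ccontr)
  assume "\<chi> \<notin> X"
  then obtain p where p: "\<chi> p = 1" "\<forall>\<psi>\<in>X. \<psi> p = 0"
    using cir_character_separation assms(1-3) by blast
  have "p = 0" using p assms(2) by (intro assms(4)) (simp add: cir_characterD(5))
  then show False using p(1) assms(3) by (simp add: cir_characterD(5))
qed

section \<open>Evaluation of double polynomials, involutions and pulled-back characters\<close>

lemma dpoly_eval_simps:
  "dpoly_eval (p + q) a = dpoly_eval p a + dpoly_eval q a"
  "dpoly_eval (dscale t p) a = t *s dpoly_eval p a"
  "dpoly_eval (dbul p q) a = dpoly_eval p a \<bullet>\<^sub>R dpoly_eval q a"
  "dpoly_eval (dcir p q) a = dpoly_eval p a \<circ>\<^sub>R dpoly_eval q a"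
  "dpoly_eval done_bul a = \<one>\<^sub>\<bullet>" "dpoly_eval done_cir a = \<one>\<^sub>\<circ>"
  "dpoly_eval 0 a = 0" "dpoly_eval dX a = a"
  by (transfer, simp)+

lemma generated_eq_range: "generated a = range (\<lambda>p. dpoly_eval p a)"
proof (rule subset_antisym)
  show "generated a \<subseteq> range (\<lambda>p. dpoly_eval p a)"
    unfolding generated_def
  proof (rule Inter_lower, safe)
    show "subspace (range (\<lambda>p. dpoly_eval p a))"
      unfolding subspace_def by safe (metis dpoly_eval_simps rangeI)+
  qed (metis dpoly_eval_simps rangeI)+
next
  have "eval_dterm a u \<in> S"
    if "subspace S \<and> a \<in> S \<and> \<one>\<^sub>\<bullet> \<in> S \<and> \<one>\<^sub>\<circ> \<in> S \<and>
     (\<forall>p\<in>S. \<forall>q\<in>S. p \<bullet>\<^sub>R q \<in> S) \<and> (\<forall>p\<in>S. \<forall>q\<in>S. p \<circ>\<^sub>R q \<in> S)" for u S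
    using that by (induction u) (auto simp: subspace_def)
  then show "range (\<lambda>p. dpoly_eval p a) \<subseteq> generated a"
    unfolding generated_def by (auto simp: dpoly_eval.rep_eq)
qed

lemma involutionD:
  assumes "involution \<sigma>"
  shows "\<sigma> (x + y) = \<sigma> x + \<sigma> y" "\<sigma> (t *s x) = t *s \<sigma> x" "\<sigma> 0 = 0" "\<sigma> (\<sigma> x) = x"
    "\<sigma> (x \<bullet>\<^sub>R y) = \<sigma> y \<bullet>\<^sub>R \<sigma> x" "\<sigma> (x \<circ>\<^sub>R y) = \<sigma> y \<circ>\<^sub>R \<sigma> x"
    "\<sigma> \<one>\<^sub>\<bullet> = \<one>\<^sub>\<bullet>" "\<sigma> \<one>\<^sub>\<circ> = \<one>\<^sub>\<circ>"
proof -
  interpret s: Vector_Spaces.linear scale scale \<sigma> using assms by (simp add: involution_def)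
  show "\<sigma> (x + y) = \<sigma> x + \<sigma> y" "\<sigma> (t *s x) = t *s \<sigma> x" "\<sigma> 0 = 0"
    by (rule s.add s.scale s.zero)+
  show \<sigma>\<sigma>: "\<sigma> (\<sigma> x) = x" for x using assms by (simp add: involution_def)
  show bul: "\<sigma> (x \<bullet>\<^sub>R y) = \<sigma> y \<bullet>\<^sub>R \<sigma> x" for x y using assms by (simp add: involution_def)
  show cir: "\<sigma> (x \<circ>\<^sub>R y) = \<sigma> y \<circ>\<^sub>R \<sigma> x" for x y using assms by (simp add: involution_def)
  show "\<sigma> \<one>\<^sub>\<bullet> = \<one>\<^sub>\<bullet>" "\<sigma> \<one>\<^sub>\<circ> = \<one>\<^sub>\<circ>"
    \<comment> \<open>In \<open>\<sigma> (1 \<bullet> \<sigma> 1) = \<sigma> (\<sigma> 1) \<bullet>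
      \<sigma> 1\<close> the left side is 1 and the right side is \<open>\<sigma> 1\<close>;
      likewise for \<open>\<circ>\<close>.\<close>
    using \<sigma>\<sigma> bul[of "\<one>\<^sub>\<bullet>" "\<sigma> \<one>\<^sub>\<bullet>"] cir[of "\<one>\<^sub>\<circ>" "\<sigma> \<one>\<^sub>\<circ>"]
    by (simp_all add: bul_one_left bul_one_right cir_one_left cir_one_right)
qed

text \<open>Reverse every product in a term representing \<open>p\<close>. One \<open>q\<close>
  serves all fixed points of \<open>\<sigma>\<close> at once. Working with a representative avoids
  showing that reversal respects \<open>dcong\<close>.\<close>

lemma involution_dpoly_eval:
  assumes "involution \<sigma>"
  shows "\<exists>q. \<forall>a. \<sigma> a = a \<longrightarrow> dpoly_eval q a = \<sigma> (dpoly_eval p a)"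
proof -
  note inv = involutionD[OF assms]
  have "\<exists>v. \<forall>a. \<sigma> a = a \<longrightarrow> eval_dterm a v = \<sigma> (eval_dterm a u)" for u
  proof (induction u)
    \<comment> \<open>The variable is where \<open>\<sigma> a = a\<close> enters.\<close>
    case TX
    show ?case by (rule exI[of _ TX]) simp
  next
    case TOneB
    show ?case by (rule exI[of _ TOneB]) (simp add: inv)
  next
    case TOneC
    show ?case by (rule exI[of _ TOneC]) (simp add: inv)
  next
    case TZero
    show ?case by (rule exI[of _ TZero]) (simp add: inv)
  next
    case (TAdd u1 u2)
    then obtain v1 v2 where "\<forall>a. \<sigma> a = a \<longrightarrow> eval_dterm a v1 = \<sigma> (eval_dterm a u1)"
      "\<forall>a. \<sigma> a = a \<longrightarrow> eval_dterm a v2 = \<sigma> (eval_dterm a u2)" by blast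
    then show ?case by (intro exI[of _ "TAdd v1 v2"]) (simp add: inv)
  next
    case (TScale t u)
    then obtain v where "\<forall>a. \<sigma> a = a \<longrightarrow> eval_dterm a v = \<sigma> (eval_dterm a u)" by blast
    then show ?case by (intro exI[of _ "TScale t v"]) (simp add: inv)
  next
    case (TBul u1 u2)
    then obtain v1 v2 where "\<forall>a. \<sigma> a = a \<longrightarrow> eval_dterm a v1 = \<sigma> (eval_dterm a u1)"
      "\<forall>a. \<sigma> a = a \<longrightarrow> eval_dterm a v2 = \<sigma> (eval_dterm a u2)" by blast
    then show ?case by (intro exI[of _ "TBul v2 v1"]) (simp add: inv)
  next
    case (TCir u1 u2)
    then obtain v1 v2 where "\<forall>a. \<sigma> a = a \<longrightarrow> eval_dterm a v1 = \<sigma> (eval_dterm a u1)"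
      "\<forall>a. \<sigma> a = a \<longrightarrow> eval_dterm a v2 = \<sigma> (eval_dterm a u2)" by blast
    then show ?case by (intro exI[of _ "TCir v2 v1"]) (simp add: inv)
  qed
  then obtain v where "\<forall>a. \<sigma> a = a \<longrightarrow> eval_dterm a v = \<sigma> (eval_dterm a (rep_dpoly p))" by blast
  then have "\<forall>a. \<sigma> a = a \<longrightarrow> dpoly_eval (abs_dpoly v) a = \<sigma> (dpoly_eval p a)"
    unfolding dpoly_eval.abs_eq by (simp add: dpoly_eval.rep_eq)
  then show ?thesis by blast
qed

text \<open>Evaluation at \<open>a\<close> is a homomorphism, so characters of \<open>R\<close> pull
  back along it to the free double algebra.\<close>

lemma cir_character_dpoly_eval:
  assumes "cir_character \<pi>"
  shows "double_algebra.cir_character dscale dcir done_cir (\<lambda>p. \<pi> (dpoly_eval p a))"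
proof -
  interpret D: double_algebra dscale dbul dcir done_bul done_cir by (rule double_algebra_dpoly)
  show ?thesis
    by (simp add: D.cir_character_def dpoly_eval_simps cir_characterD[OF assms])
qed

text \<open>The reversal of products by \<open>\<sigma>\<close> is undone by commutativity of the
  field.\<close>

lemma cir_character_involution:
  assumes "involution \<sigma>" "cir_character \<pi>"
  shows "cir_character (\<lambda>x. \<pi> (\<sigma> x))"
  by (simp add: cir_character_def involutionD[OF assms(1)] cir_characterD[OF assms(2)] mult.commute)

section \<open>From dual families to bases of primitive idempotents\<close>

text \<open>Applying the character attached to \<open>e\<close> to a vanishing linear combination
  isolates the coefficient of \<open>e\<close>.\<close>

lemma independent_if_dual:
  assumes "\<And>e. e \<in> E \<Longrightarrow> \<exists>\<pi>. cir_character \<pi> \<and> \<pi> e \<noteq> 0 \<and> (\<forall>e'\<in>E - {e}. \<pi> e' = 0)"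
  shows "independent E"
  unfolding independent_explicit_module
proof (intro allI impI)
  fix S u e
  assume S: "finite S" "S \<subseteq> E" "(\<Sum>v\<in>S. u v *s v) = 0" "e \<in> S"
  obtain \<pi> where \<pi>: "cir_character \<pi>" "\<pi> e \<noteq> 0" "\<forall>e'\<in>E - {e}. \<pi> e' = 0"
    using assms S by blast
  have "0 = \<pi> (\<Sum>v\<in>S. u v *s v)" using S by (simp add: cir_characterD[OF \<pi>(1)])
  also have "\<dots> = (\<Sum>v\<in>S. u v * \<pi> v)"
    by (simp add: cir_character_sum[OF \<pi>(1)] cir_characterD[OF \<pi>(1)])
  also have "\<dots> = (\<Sum>v\<in>S. if v = e then u e * \<pi> e else 0)"
    using \<pi> S by (intro sum.cong) auto
  also have "\<dots> = u e * \<pi> e" using S by simp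
  finally show "u e = 0" using \<pi>(2) by simp
qed

text \<open>In an orthogonal splitting \<open>e = f + g\<close> the part \<open>f\<close> equals
  \<open>f \<circ> e\<close>, hence is a multiple \<open>c *s e\<close>. Idempotency forces
  \<open>c\<close> to be 0 or 1, so \<open>f\<close> or \<open>g\<close> vanishes.\<close>

lemma primitive_circ_idempotentI:
  assumes "e \<in> S" "circ_idempotent e" "e \<noteq> 0" "\<And>f. f \<in> S \<Longrightarrow> \<exists>c. f \<circ>\<^sub>R e = c *s e"
  shows "primitive_circ_idempotent S e"
proof -
  have False
    if f: "f \<in> S" "circ_idempotent f" "f \<noteq> 0" and g: "g \<noteq> 0" "f \<circ>\<^sub>R g = 0" "e = f + g" for f g
  proof -
    obtain c where "f \<circ>\<^sub>R e = c *s e" using assms(4) f(1) by blast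
    moreover have "f \<circ>\<^sub>R e = f" using f g by (simp add: cir_add_right circ_idempotent_def)
    ultimately have fc: "f = c *s e" by simp
    have "(c * c) *s e = c *s e"
      using f(2) assms(2) unfolding fc by (simp add: circ_idempotent_def cir_scale_left cir_scale_right)
    then have "c * c = c" using assms(3) by simp
    then have "c = 0 \<or> c = 1" by simp
    then show False using fc f(3) g(1,3) by auto
  qed
  then show ?thesis using assms(1-3) by (auto simp: primitive_circ_idempotent_def)
qed

text \<open>For fixed \<open>a\<close>, pulling back along evaluation partitions
  \<open>\<Delta>\<close> into fibres indexed by \<open>X\<close>. The values at \<open>a\<close> of
  the dual family are the indicators of these fibres, with empty fibres giving 0.\<close>

lemma universal_circ_idempotent_basis_dual_family:
  assumes \<Delta>: "finite \<Delta>" "\<And>\<pi>. \<pi> \<in> \<Delta> \<Longrightarrow> cir_character \<pi>"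
    and sep: "\<And>x y. (\<And>\<pi>. \<pi> \<in> \<Delta> \<Longrightarrow> \<pi> x = \<pi> y) \<Longrightarrow> x = y"
    and A: "finite A"
    and X: "X = (\<lambda>(a, \<pi>) p. \<pi> (dpoly_eval p a)) ` (A \<times> \<Delta>)"
    and b: "\<forall>\<chi>\<in>X. \<forall>\<psi>\<in>X. \<psi> (b \<chi>) = (if \<psi> = \<chi> then 1 else 0)"
  shows "universal_circ_idempotent_basis A (b ` X)"
proof -
  have fX: "finite X" using A \<Delta> by (simp add: X)
  have basis: "circ_idempotent_basis (generated a) {r. r \<noteq> 0 \<and> (\<exists>d\<in>b ` X. r = dpoly_eval d a)}"
    (is "circ_idempotent_basis _ ?E")
    and inj: "\<And>\<chi> \<chi>'. \<chi> \<in> X \<Longrightarrow> \<chi>' \<in> X \<Longrightarrow> \<chi> \<noteq> \<chi>' \<Longrightarrow> dpoly_eval (b \<chi>) a \<noteq> 0 \<Longrightarrow>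
        dpoly_eval (b \<chi>) a \<noteq> dpoly_eval (b \<chi>') a" if a: "a \<in> A" for a
  proof -
    define r where "r \<chi> = dpoly_eval (b \<chi>) a" for \<chi>
    define \<theta> where "\<theta> \<pi> = (\<lambda>p. \<pi> (dpoly_eval p a))" for \<pi> :: "'r \<Rightarrow> 'f"
    have \<theta>X: "\<theta> \<pi> \<in> X" if "\<pi> \<in> \<Delta>" for \<pi> using that a by (force simp: X \<theta>_def)
    \<comment> \<open>The coordinates of \<open>r \<chi>\<close> are those of the indicator of the
      fibre of \<open>\<theta>\<close> over \<open>\<chi>\<close>.\<close>
    have coord: "\<pi> (r \<chi>) = (if \<theta> \<pi> = \<chi> then 1 else 0)" if "\<pi> \<in> \<Delta>" "\<chi> \<in> X" for \<pi> \<chi>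
      using b[rule_format, OF that(2) \<theta>X[OF that(1)]] by (simp add: \<theta>_def r_def)
    have nz: "\<exists>\<pi>\<in>\<Delta>. \<theta> \<pi> = \<chi>" if "r \<chi> \<noteq> 0" "\<chi> \<in> X" for \<chi>
    proof (rule ccontr)
      assume "\<not> ?thesis"
      then have "r \<chi> = 0"
        using that by (intro sep) (auto simp: coord cir_characterD(5)[OF \<Delta>(2)])
      then show False using that by simp
    qed
    have E: "?E = {r \<chi> | \<chi>. \<chi> \<in> X \<and> r \<chi> \<noteq> 0}" by (auto simp: r_def)
    \<comment> \<open>On the fibre over \<open>\<chi>\<close> the element
      \<open>dpoly_eval q a\<close> has constant coordinate \<open>\<chi> q\<close>; elsewhere
      \<open>r \<chi>\<close> vanishes. This gives both idempotency and primitivity below.\<close>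
    have expand: "dpoly_eval q a \<circ>\<^sub>R r \<chi> = \<chi> q *s r \<chi>" if "\<chi> \<in> X" for q \<chi>
      using that by (intro sep) (auto simp: cir_characterD[OF \<Delta>(2)] coord \<theta>_def)
    \<comment> \<open>Each \<open>\<pi>\<close> lies in exactly one fibre, so a single summand
      survives under it.\<close>
    have total: "dpoly_eval q a = (\<Sum>\<chi>\<in>X. \<chi> q *s r \<chi>)" for q
    proof (rule sep)
      fix \<pi> assume \<pi>: "\<pi> \<in> \<Delta>"
      have "\<pi> (\<Sum>\<chi>\<in>X. \<chi> q *s r \<chi>) = (\<Sum>\<chi>\<in>X. if \<theta> \<pi> = \<chi> then \<theta> \<pi> q else 0)"
        using \<pi> by (auto simp: cir_character_sum[OF \<Delta>(2)] cir_characterD[OF \<Delta>(2)] coord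
          intro!: sum.cong)
      then show "\<pi> (dpoly_eval q a) = \<pi> (\<Sum>\<chi>\<in>X. \<chi> q *s r \<chi>)"
        using fX \<theta>X[OF \<pi>] by (simp add: \<theta>_def)
    qed
    show "dpoly_eval (b \<chi>) a \<noteq> dpoly_eval (b \<chi>') a"
      if "\<chi> \<in> X" "\<chi>' \<in> X" "\<chi> \<noteq> \<chi>'" "dpoly_eval (b \<chi>) a \<noteq> 0" for \<chi> \<chi>'
      using nz[of \<chi>] coord that by (metis r_def zero_neq_one)
    have "independent ?E"
    proof (rule independent_if_dual)
      fix e assume "e \<in> ?E"
      then obtain \<chi> where \<chi>: "e = r \<chi>" "\<chi> \<in> X" "r \<chi> \<noteq> 0" unfolding E by blast
      then obtain \<pi> where \<pi>: "\<pi> \<in> \<Delta>" "\<theta> \<pi> = \<chi>" using nz by blast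
      have "\<pi> e = 1" using \<chi> \<pi> by (simp add: coord)
      moreover have "\<pi> e' = 0" if "e' \<in> ?E - {e}" for e'
        using that \<chi> \<pi> unfolding E by (auto simp: coord)
      ultimately show "\<exists>\<pi>. cir_character \<pi> \<and> \<pi> e \<noteq> 0 \<and> (\<forall>e'\<in>?E - {e}. \<pi> e' = 0)"
        using \<Delta>(2)[OF \<pi>(1)] by (intro exI[of _ \<pi>]) simp
    qed
    moreover have "span ?E = generated a"
    proof (rule subset_antisym)
      show "span ?E \<subseteq> generated a"
      proof (rule span_minimal)
        show "?E \<subseteq> generated a" by (auto simp: generated_eq_range)
        show "subspace (generated a)" unfolding generated_def by (rule subspace_Inter) auto
      qed
    next
      \<comment> \<open>Zero values are excluded from \<open>?E\<close> but still lie in its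
        span.\<close>
      have "r \<chi> \<in> span ?E" if "\<chi> \<in> X" for \<chi>
      proof (cases "r \<chi> = 0")
        case False
        then show ?thesis using that unfolding E by (intro span_base) blast
      qed (simp add: span_zero)
      then have "dpoly_eval q a \<in> span ?E" for q
        unfolding total by (intro span_sum span_scale)
      then show "generated a \<subseteq> span ?E" by (auto simp: generated_eq_range)
    qed
    moreover have "primitive_circ_idempotent (generated a) e" if "e \<in> ?E" for e
    proof -
      obtain \<chi> where \<chi>: "e = r \<chi>" "\<chi> \<in> X" "r \<chi> \<noteq> 0" using \<open>e \<in> ?E\<close> unfolding E by blast
      show ?thesis
      proof (rule primitive_circ_idempotentI)
        show "e \<in> generated a" by (simp add: generated_eq_range \<chi> r_def)
        show "circ_idempotent e"
          \<comment> \<open>Take \<open>q = b \<chi>\<close>, for which the eigenvalue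
            \<open>\<chi> q\<close> is 1.\<close>
          using expand[OF \<chi>(2), of "b \<chi>"] b[rule_format, OF \<chi>(2) \<chi>(2)]
          by (simp add: circ_idempotent_def r_def \<chi>(1))
        show "e \<noteq> 0" using \<chi> by simp
        show "\<exists>c. f \<circ>\<^sub>R e = c *s e" if "f \<in> generated a" for f
          using that expand[OF \<chi>(2)] \<chi>(1) by (auto simp: generated_eq_range)
      qed
    qed
    ultimately show "circ_idempotent_basis (generated a) ?E"
      by (simp add: circ_idempotent_basis_def)
  qed
  show ?thesis
    unfolding universal_circ_idempotent_basis_def using basis inj by blast
qed

text \<open>Precomposition with reversal sends the character of \<open>(a, \<pi>)\<close> to that of
  \<open>(a, \<pi> \<circ> \<sigma>)\<close>. This involution of \<open>X\<close> is transported to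
  the dual family.\<close>

lemma universal_circ_idempotent_basis_with_involution:
  assumes \<sigma>: "involution \<sigma>"
    and \<Delta>: "finite \<Delta>" "\<And>\<pi>. \<pi> \<in> \<Delta> \<Longrightarrow> cir_character \<pi>"
    and sep: "\<And>x y. (\<And>\<pi>. \<pi> \<in> \<Delta> \<Longrightarrow> \<pi> x = \<pi> y) \<Longrightarrow> x = y"
    and A: "finite A" "A \<subseteq> {r. \<sigma> r = r}"
  shows "\<exists>B \<sigma>\<^sub>B. finite B \<and> universal_circ_idempotent_basis A B \<and>
    (\<forall>b\<in>B. \<sigma>\<^sub>B b \<in> B) \<and> (\<forall>b\<in>B. \<sigma>\<^sub>B (\<sigma>\<^sub>B b) = b) \<and>
    (\<forall>a\<in>A. \<forall>b\<in>B. \<sigma> (dpoly_eval b a) = dpoly_eval (\<sigma>\<^sub>B b) a)"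
proof -
  interpret D: double_algebra dscale dbul dcir done_bul done_cir by (rule double_algebra_dpoly)
  define X where "X = (\<lambda>(a, \<pi>) p. \<pi> (dpoly_eval p a)) ` (A \<times> \<Delta>)"
  have fX: "finite X" using A \<Delta> by (simp add: X_def)
  have "D.cir_character \<chi>" if "\<chi> \<in> X" for \<chi>
    using that \<Delta>(2) by (auto simp: X_def intro: cir_character_dpoly_eval)
  then obtain b where b: "\<forall>\<chi>\<in>X. \<forall>\<psi>\<in>X. \<psi> (b \<chi>) = (if \<psi> = \<chi> then 1 else 0)"
    using D.cir_character_dual_family[OF fX] by blast
  have b': "\<psi> (b \<chi>) = (if \<psi> = \<chi> then 1 else 0)" if "\<chi> \<in> X" "\<psi> \<in> X" for \<chi> \<psi>
    using b[rule_format, OF that] .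
  \<comment> \<open>Needed to recover \<open>\<chi>\<close> from \<open>b \<chi>\<close> when
    defining \<open>\<sigma>\<^sub>B\<close> on polynomials.\<close>
  have "inj_on b X"
  proof (rule inj_onI)
    fix \<chi> \<psi> assume *: "\<chi> \<in> X" "\<psi> \<in> X" "b \<chi> = b \<psi>"
    have "\<chi> (b \<chi>) = 1" "\<chi> (b \<psi>) = (if \<chi> = \<psi> then 1 else 0)"
      using b'[of \<chi> \<chi>] b'[of \<psi> \<chi>] * by simp_all
    then show "\<chi> = \<psi>" using *(3) by (simp split: if_splits)
  qed
  \<comment> \<open>The choice \<open>\<tau>\<close> may be neither linear nor involutive, but
    characters in \<open>X\<close> see only values at points of \<open>A\<close>, where it acts as
    \<open>\<sigma>\<close>.\<close>
  have "\<exists>\<tau>. \<forall>p. \<forall>a. \<sigma> a = a \<longrightarrow> dpoly_eval (\<tau> p) a = \<sigma> (dpoly_eval p a)"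
    by (rule choice) (use involution_dpoly_eval[OF \<sigma>] in blast)
  then obtain \<tau> where "\<forall>p. \<forall>a. \<sigma> a = a \<longrightarrow> dpoly_eval (\<tau> p) a = \<sigma> (dpoly_eval p a)" by blast
  then have \<tau>: "dpoly_eval (\<tau> p) a = \<sigma> (dpoly_eval p a)" if "a \<in> A" for p a
    using that A(2) by blast
  have \<sigma>\<sigma>: "\<sigma> (\<sigma> x) = x" for x by (rule involutionD(4)[OF \<sigma>])
  define s where "s \<chi> = \<chi> \<circ> \<tau>" for \<chi> :: "'f dpoly \<Rightarrow> 'f"
  have sX: "s \<chi> \<in> X" and ss: "s (s \<chi>) = \<chi>" if "\<chi> \<in> X" for \<chi>
  proof -
    obtain a \<pi> where a: "a \<in> A" "\<pi> \<in> \<Delta>" and \<chi>: "\<chi> = (\<lambda>p. \<pi> (dpoly_eval p a))"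
      using \<open>\<chi> \<in> X\<close> by (auto simp: X_def)
    \<comment> \<open>Since \<open>\<Delta>\<close> separates points, it contains every character,
      in particular this one.\<close>
    have "(\<lambda>x. \<pi> (\<sigma> x)) \<in> \<Delta>"
      using cir_character_in_separating_set[OF \<Delta> cir_character_involution[OF \<sigma> \<Delta>(2)[OF a(2)]] sep]
      by blast
    moreover have "s \<chi> = (\<lambda>p. (\<lambda>x. \<pi> (\<sigma> x)) (dpoly_eval p a))"
      by (simp add: s_def \<chi> \<tau>[OF a(1)] fun_eq_iff)
    ultimately show "s \<chi> \<in> X" using a(1) unfolding X_def by force
    show "s (s \<chi>) = \<chi>" by (simp add: s_def \<chi> \<tau>[OF a(1)] \<sigma>\<sigma> fun_eq_iff)
  qed
  define \<sigma>\<^sub>B where "\<sigma>\<^sub>B d = b (s (the_inv_into X b d))" for d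
  have \<sigma>\<^sub>B: "\<sigma>\<^sub>B (b \<chi>) = b (s \<chi>)" if "\<chi> \<in> X" for \<chi>
    using that \<open>inj_on b X\<close> by (simp add: \<sigma>\<^sub>B_def the_inv_into_f_f)
  have "\<sigma> (dpoly_eval (b \<chi>) a) = dpoly_eval (b (s \<chi>)) a" if "a \<in> A" "\<chi> \<in> X" for a \<chi>
  proof (rule sep)
    fix \<pi> assume "\<pi> \<in> \<Delta>"
    define \<psi> where "\<psi> = (\<lambda>p. \<pi> (dpoly_eval p a))"
    have \<psi>: "\<psi> \<in> X" using \<open>\<pi> \<in> \<Delta>\<close> \<open>a \<in> A\<close> by (force simp: X_def \<psi>_def)
    have "\<pi> (\<sigma> (dpoly_eval (b \<chi>) a)) = s \<psi> (b \<chi>)"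
      by (simp add: s_def \<psi>_def \<tau>[OF \<open>a \<in> A\<close>])
    also have "\<dots> = (if s \<psi> = \<chi> then 1 else 0)" by (rule b'[OF \<open>\<chi> \<in> X\<close> sX[OF \<psi>]])
    \<comment> \<open>As \<open>s\<close> is an involution on \<open>X\<close>,
      \<open>s \<psi> = \<chi>\<close> and \<open>\<psi> = s \<chi>\<close> are equivalent.\<close>
    also have "\<dots> = (if \<psi> = s \<chi> then 1 else 0)" using ss \<psi> \<open>\<chi> \<in> X\<close> by metis
    also have "\<dots> = \<psi> (b (s \<chi>))" by (rule b'[OF sX[OF \<open>\<chi> \<in> X\<close>] \<psi>, symmetric])
    finally show "\<pi> (\<sigma> (dpoly_eval (b \<chi>) a)) = \<pi> (dpoly_eval (b (s \<chi>)) a)"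
      by (simp add: \<psi>_def)
  qed
  moreover have "universal_circ_idempotent_basis A (b ` X)"
    by (rule universal_circ_idempotent_basis_dual_family[OF \<Delta> sep A(1) X_def b])
  ultimately show ?thesis
    using fX by (intro exI[of _ "b ` X"] exI[of _ \<sigma>\<^sub>B]) (auto simp: \<sigma>\<^sub>B sX ss)
qed

section \<open>Characters of a commutative split semisimple algebra\<close>

text \<open>Commutativity forces all matrix blocks to have size 1. Their single entries are the
  characters, and injectivity of the isomorphism makes them separate points.\<close>

lemma split_semisimple_commutative_characters:
  assumes comm: "\<And>x y. x \<circ>\<^sub>R y = y \<circ>\<^sub>R x" and "split_semisimple scale cir \<one>\<^sub>\<circ>"
  obtains \<Delta> where "finite \<Delta>" "\<And>\<pi>. \<pi> \<in> \<Delta> \<Longrightarrow> cir_character \<pi>"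
    "\<And>x y. (\<And>\<pi>. \<pi> \<in> \<Delta> \<Longrightarrow> \<pi> x = \<pi> y) \<Longrightarrow> x = y"
proof -
  obtain k n and \<phi> :: "'r \<Rightarrow> nat \<Rightarrow> 'f mat" where n: "\<And>i. i < k \<Longrightarrow> n i > 0"
    and bij: "bij_betw \<phi> UNIV (\<Pi>\<^sub>E i\<in>{..<k}. carrier_mat (n i) (n i))"
    and \<phi>: "\<And>i x y. i < k \<Longrightarrow> \<phi> (x + y) i = \<phi> x i + \<phi> y i"
      "\<And>i t x. i < k \<Longrightarrow> \<phi> (t *s x) i = t \<cdot>\<^sub>m \<phi> x i"
      "\<And>i x y. i < k \<Longrightarrow> \<phi> (x \<circ>\<^sub>R y) i = \<phi> x i * \<phi> y i"
      "\<And>i. i < k \<Longrightarrow> \<phi> \<one>\<^sub>\<circ> i = 1\<^sub>m (n i)"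
    using assms(2) unfolding split_semisimple_def by blast
  have mem: "\<phi> x \<in> (\<Pi>\<^sub>E i\<in>{..<k}. carrier_mat (n i) (n i))" for x
    using bij by (auto simp: bij_betw_def)
  have car: "\<phi> x i \<in> carrier_mat (n i) (n i)" if "i < k" for x i
    using mem that by (auto simp: PiE_iff)
  have n1: "n i = 1" if i: "i < k" for i
  proof (rule ccontr)
    assume "n i \<noteq> 1"
    with n[OF i] have n2: "n i \<ge> 2" by linarith
    \<comment> \<open>By surjectivity, any matrix occurs in block \<open>i\<close>; the other blocks
      are filled with 0.\<close>
    have ex: "\<exists>x. \<phi> x i = M" if M: "M \<in> carrier_mat (n i) (n i)" for M
    proof -
      have "(\<lambda>j\<in>{..<k}. if j = i then M else 0\<^sub>m (n j) (n j)) \<in> (\<Pi>\<^sub>E i\<in>{..<k}. carrier_mat (n i) (n i))"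
        using M by auto
      then obtain x where x: "(\<lambda>j\<in>{..<k}. if j = i then M else 0\<^sub>m (n j) (n j)) = \<phi> x"
        using bij unfolding bij_betw_def by blast
      have "\<phi> x i = M" using i by (simp flip: x)
      then show ?thesis by blast
    qed
    \<comment> \<open>Matrix units with \<open>U * V\<close> and \<open>V * U\<close> the diagonal
      units at positions 0 and 1; they differ at entry \<open>(0, 0)\<close>.\<close>
    define U V :: "'f mat"
      where "U = mat (n i) (n i) (\<lambda>(p, q). if p = 0 \<and> q = 1 then 1 else 0)"
        and "V = mat (n i) (n i) (\<lambda>(p, q). if p = 1 \<and> q = 0 then 1 else 0)"
    obtain x y where "\<phi> x i = U" "\<phi> y i = V" using ex[of U] ex[of V] by (auto simp: U_def V_def)
    then have "U * V = V * U" using \<phi>(3)[OF i] comm by metis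
    moreover have "(U * V) $$ (0, 0) = (\<Sum>j = 0..<n i. if j = Suc 0 then 1 else 0)"
      using n2 by (simp add: U_def V_def scalar_prod_def if_distrib[of "\<lambda>c. c * _"] cong: if_cong)
    moreover have "(V * U) $$ (0, 0) = 0"
      using n2 by (auto simp: U_def V_def scalar_prod_def intro!: sum.neutral)
    ultimately show False using n2 by simp
  qed
  define \<Delta> where "\<Delta> = (\<lambda>i x. \<phi> x i $$ (0, 0)) ` {..<k}"
  have "cir_character (\<lambda>x. \<phi> x i $$ (0, 0))" if i: "i < k" for i
  proof -
    have dim: "dim_row (\<phi> x i) = 1" "dim_col (\<phi> x i) = 1" for x
      using car[OF i] n1[OF i] by auto
    show ?thesis
      by (simp add: cir_character_def \<phi>[OF i] n1[OF i] dim scalar_prod_def)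
  qed
  then have "\<And>\<pi>. \<pi> \<in> \<Delta> \<Longrightarrow> cir_character \<pi>" by (auto simp: \<Delta>_def)
  moreover have "x = y" if xy: "\<And>\<pi>. \<pi> \<in> \<Delta> \<Longrightarrow> \<pi> x = \<pi> y" for x y
  proof -
    have "\<phi> x i = \<phi> y i" if i: "i < k" for i
    proof (rule eq_matI)
      have "\<phi> x i $$ (0, 0) = \<phi> y i $$ (0, 0)" using xy[of "\<lambda>x. \<phi> x i $$ (0, 0)"] i by (simp add: \<Delta>_def)
      then show "\<phi> x i $$ (p, q) = \<phi> y i $$ (p, q)"
        if "p < dim_row (\<phi> y i)" "q < dim_col (\<phi> y i)" for p q
        using that car[OF i, of y] n1[OF i] by auto
    qed (use car[OF i, of x] car[OF i, of y] in auto)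
    \<comment> \<open>Outside \<open>{..<k}\<close> the two agree because both are extensional
      functions.\<close>
    then have "\<phi> x = \<phi> y" by (intro PiE_ext[OF mem mem]) simp
    then show "x = y" using bij by (auto simp: bij_betw_def dest: injD)
  qed
  ultimately show ?thesis by (intro that[of \<Delta>]) (simp_all add: \<Delta>_def)
qed

end

theorem theorem2p10:
  fixes scale :: "'f::field \<Rightarrow> 'r::ab_group_add \<Rightarrow> 'r"
    and bul cir :: "'r \<Rightarrow> 'r \<Rightarrow> 'r"
    and one_bul one_cir :: 'r
    and \<sigma> :: "'r \<Rightarrow> 'r"
    and A :: "'r set"
  assumes "double_algebra scale bul cir one_bul one_cir"
    and "double_algebra.involution scale bul cir \<sigma>"
    and "\<forall>a b. cir a b = cir b a"
    and "split_semisimple scale cir one_cir"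
    and "finite_dimensional scale"
    and "finite A"
    and "A \<subseteq> {r. \<sigma> r = r}"
  shows "\<exists>(B :: 'f dpoly set) (\<sigma>\<^sub>B :: 'f dpoly \<Rightarrow> 'f dpoly).
    finite B \<and>
    double_algebra.universal_circ_idempotent_basis scale bul cir one_bul one_cir A B \<and>
    (\<forall>b\<in>B. \<sigma>\<^sub>B b \<in> B) \<and>
    (\<forall>b\<in>B. \<sigma>\<^sub>B (\<sigma>\<^sub>B b) = b) \<and>
    (\<forall>a\<in>A. \<forall>b\<in>B.
       \<sigma> (double_algebra.dpoly_eval scale bul cir one_bul one_cir b a) =
       double_algebra.dpoly_eval scale bul cir one_bul one_cir (\<sigma>\<^sub>B b) a)"
proof -
  interpret double_algebra scale bul cir one_bul one_cir by fact
  have comm: "cir x y = cir y x" for x y using assms(3) by blast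
  show ?thesis
  proof (rule split_semisimple_commutative_characters[OF comm assms(4)])
    fix \<Delta>
    assume \<Delta>: "finite \<Delta>" "\<And>\<pi>. \<pi> \<in> \<Delta> \<Longrightarrow> cir_character \<pi>"
      and sep: "\<And>x y. (\<And>\<pi>. \<pi> \<in> \<Delta> \<Longrightarrow> \<pi> x = \<pi> y) \<Longrightarrow> x = y"
    show ?thesis
      by (rule universal_circ_idempotent_basis_with_involution[OF assms(2) \<Delta> sep assms(6,7)])
  qed
qed

end
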